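(* There is a polynomial-time algorithm which, given a finite simple graph $G$, decides whether $G$ has a locally complete 2-edge-colouring and finds one if it exists.
   Context: A 2-edge-colouring of a graph $G$ is an arbitrary map $E(G)\to\{1,2\}$ (not necessarily proper). It is locally complete if for each vertex $v$ and each colour $c$, the vertices joined to $v$ by edges of colour $c$ induce a complete subgraph of $G$; equivalently, $G$ has no monochromatic induced path with two edges. *)

theory Defs
  imports Main "HOL-Computational_Algebra.Polynomial"
begin

definition simple_graph :: "'a set \<Rightarrow> 'a set set \<Rightarrow> bool" where
  "simple_graph V E \<longleftrightarrow> finite V \<and> (\<forall>e\<in>E. e \<subseteq> V \<and> card e = 2)"

definition induces_complete :: "'a set set \<Rightarrow> 'a set \<Rightarrow> bool" where
  "induces_complete E S \<longleftrightarrow> (\<forall>u\<in>S. \<forall>w\<in>S. u \<noteq> w \<longrightarrow> {u, w} \<in> E)"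

definition two_edge_colouring :: "'a set set \<Rightarrow> ('a set \<Rightarrow> nat) \<Rightarrow> bool" where
  "two_edge_colouring E c \<longleftrightarrow> (\<forall>e\<in>E. c e \<in> {1, 2})"

definition colour_nbrs :: "'a set set \<Rightarrow> ('a set \<Rightarrow> nat) \<Rightarrow> 'a \<Rightarrow> nat \<Rightarrow> 'a set" where
  "colour_nbrs E c v k = {u. {v, u} \<in> E \<and> c {v, u} = k}"

definition locally_complete_colouring ::
    "'a set \<Rightarrow> 'a set set \<Rightarrow> ('a set \<Rightarrow> nat) \<Rightarrow> bool" where
  "locally_complete_colouring V E c \<longleftrightarrow>
     two_edge_colouring E c \<and>
     (\<forall>v\<in>V. \<forall>k\<in>{1, 2}. induces_complete E (colour_nbrs E c v k))"

text \<open>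
  The model of computation is the random access machine with addition and truncated
  subtraction but no multiplication, every instruction costing one time unit. Since one
  instruction lengthens the largest number in the machine by at most one bit (the constants of
  the program aside), unit-cost time is polynomially related to Turing machine time.

  A program mentions only finitely many registers; the unbounded storage is the memory, which
  is accessed indirectly through \<open>Load\<close> and \<open>Store\<close>. The last arguments of \<open>Const\<close> and of
  the jumps are literal numbers, all other arguments are register names. The first register is
  the destination, except that for \<open>Store\<close> it holds the destination address and for
  \<open>JumpZero\<close> it is the one tested.
\<close>

datatype instr =
    Const nat nat
  | Add nat nat nat
  | Sub nat nat nat
  | Load nat nat
  | Store nat nat
  | Jump nat
  | JumpZero nat nat

text \<open>Program counter, registers, memory.\<close>

type_synonym config = "nat \<times> (nat \<Rightarrow> nat) \<times> (nat \<Rightarrow> nat)"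

fun exec_instr :: "instr \<Rightarrow> config \<Rightarrow> config" where
  "exec_instr (Const r k) (pc, R, M) = (Suc pc, R(r := k), M)"
| "exec_instr (Add r s t) (pc, R, M) = (Suc pc, R(r := R s + R t), M)"
| "exec_instr (Sub r s t) (pc, R, M) = (Suc pc, R(r := R s - R t), M)"
| "exec_instr (Load r s) (pc, R, M) = (Suc pc, R(r := M (R s)), M)"
| "exec_instr (Store r s) (pc, R, M) = (Suc pc, R, M(R r := R s))"
| "exec_instr (Jump l) (pc, R, M) = (l, R, M)"
| "exec_instr (JumpZero r l) (pc, R, M) = (if R r = 0 then l else Suc pc, R, M)"

definition halted :: "instr list \<Rightarrow> config \<Rightarrow> bool" where
  "halted P cf \<longleftrightarrow> length P \<le> fst cf"

definition step :: "instr list \<Rightarrow> config \<Rightarrow> config" where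
  "step P cf = (if halted P cf then cf else exec_instr (P ! fst cf) cf)"

text \<open>
  Input and output are lists of numbers occupying an initial segment of the memory, whose
  length is in register 0.
\<close>

definition init_config :: "nat list \<Rightarrow> config" where
  "init_config xs =
     (0, (\<lambda>_. 0)(0 := length xs), (\<lambda>i. if i < length xs then xs ! i else 0))"

definition ram_output :: "config \<Rightarrow> nat list" where
  "ram_output cf = (case cf of (pc, R, M) \<Rightarrow> map M [0..<R 0])"

definition computes_within :: "instr list \<Rightarrow> nat list \<Rightarrow> nat \<Rightarrow> nat list \<Rightarrow> bool" where
  "computes_within P xs t ys \<longleftrightarrow>
     (let cf = (step P ^^ t) (init_config xs) in halted P cf \<and> ram_output cf = ys)"

text \<open>
  With respect to an enumeration \<open>vs\<close> of its vertices, a graph is given to the machine as the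
  number of vertices followed by the adjacency matrix, row by row. The length of this list is
  one plus the square of its first entry and all other entries are 0 or 1, so the length is a
  measure of the input size up to a logarithmic term. A colouring is given as the matrix of
  the colours of the edges, with 0 at non-adjacent pairs.
\<close>

definition graph_code :: "'a list \<Rightarrow> 'a set set \<Rightarrow> nat list" where
  "graph_code vs E = length vs # [if {u, v} \<in> E then 1 else 0. u \<leftarrow> vs, v \<leftarrow> vs]"

definition colouring_code :: "'a list \<Rightarrow> 'a set set \<Rightarrow> ('a set \<Rightarrow> nat) \<Rightarrow> nat list" where
  "colouring_code vs E c = [if {u, v} \<in> E then c {u, v} else 0. u \<leftarrow> vs, v \<leftarrow> vs]"

definition correct_answer :: "'a set \<Rightarrow> 'a set set \<Rightarrow> 'a list \<Rightarrow> nat list \<Rightarrow> bool" where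
  "correct_answer V E vs ys \<longleftrightarrow>
     (if \<exists>c. locally_complete_colouring V E c
      then \<exists>c. locally_complete_colouring V E c \<and> ys = 1 # colouring_code vs E c
      else ys = [0])"

end

theory Submission
  imports Defs
begin

text \<open>
  A colouring is locally complete iff edges \<open>ij\<close> and \<open>jk\<close> have different colours whenever \<open>i \<noteq> k\<close> and
  \<open>ik\<close> is not an edge. Working with ordered pairs, every triple \<open>(i, j, k)\<close> with \<open>ij\<close>, \<open>jk\<close> edges and
  \<open>ik\<close> not an edge gives one constraint: \<open>(i, j)\<close> and \<open>(j, k)\<close> have equal colours if \<open>i = k\<close>, and
  different colours otherwise. These constraints are solved by merging label classes on the pairs
  and their negations. Under every solution, nodes with equal labels have equal truth values, so
  there is none if a pair and its negation share a label. Otherwise a constraint that asks for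
  different colours exchanges the labels of pair and negation, and colouring each pair by
  comparing its label with that of its negation is a solution.
\<close>

section \<open>A language of bounded loops\<close>

text \<open>Every loop is bounded by the value of a register, so termination is built in and a
  polynomial time bound can be read off the syntax.\<close>

datatype com =
    Skip
  | Basic instr
  | Seq com com
  | IfZero nat com com
  | For nat nat com

type_synonym store = "(nat \<Rightarrow> nat) \<times> (nat \<Rightarrow> nat)"

text \<open>Register 1 is the scratch register of all loops.\<close>

definition enter_loop :: "nat \<Rightarrow> nat \<Rightarrow> nat \<Rightarrow> store \<Rightarrow> store" where
  "enter_loop i b k s = ((fst s)(i := k, 1 := b - k), snd s)"

text \<open>The loop case puts the number of remaining rounds into register 1 because the compiled
  test leaves it there; thus \<open>sem\<close> describes the exact machine state.\<close>

primrec sem :: "com \<Rightarrow> store \<Rightarrow> store" where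
  "sem Skip s = s"
| "sem (Basic ins) s = snd (exec_instr ins (0, s))"
| "sem (Seq c d) s = sem d (sem c s)"
| "sem (IfZero r c d) s = (if fst s r = 0 then sem c s else sem d s)"
| "sem (For i b c) s = enter_loop i (fst s b) (fst s b)
     (fold (\<lambda>k. sem c \<circ> enter_loop i (fst s b) k) [0..<fst s b] s)"

fun instr_writes :: "instr \<Rightarrow> nat set" where
  "instr_writes (Const r _) = {r}"
| "instr_writes (Add r _ _) = {r}"
| "instr_writes (Sub r _ _) = {r}"
| "instr_writes (Load r _) = {r}"
| "instr_writes _ = {}"

primrec writes :: "com \<Rightarrow> nat set" where
  "writes Skip = {}"
| "writes (Basic ins) = instr_writes ins"
| "writes (Seq c d) = writes c \<union> writes d"
| "writes (IfZero r c d) = writes c \<union> writes d"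
| "writes (For i b c) = insert i (insert 1 (writes c))"

primrec loop_bounds :: "com \<Rightarrow> nat set" where
  "loop_bounds Skip = {}"
| "loop_bounds (Basic ins) = {}"
| "loop_bounds (Seq c d) = loop_bounds c \<union> loop_bounds d"
| "loop_bounds (IfZero r c d) = loop_bounds c \<union> loop_bounds d"
| "loop_bounds (For i b c) = insert b (loop_bounds c)"

fun sequential :: "instr \<Rightarrow> bool" where
  "sequential (Jump _) = False"
| "sequential (JumpZero _ _) = False"
| "sequential _ = True"

text \<open>The disjointness conditions keep each loop bound at its initial value until its loop is
  done, so running times can be bounded from the initial registers. The counter must survive the
  body because the machine increments it in place.\<close>

primrec well_formed :: "com \<Rightarrow> bool" where
  "well_formed Skip = True"
| "well_formed (Basic ins) = sequential ins"
| "well_formed (Seq c d) = (well_formed c \<and> well_formed d \<and> writes c \<inter> loop_bounds d = {})"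
| "well_formed (IfZero r c d) = (well_formed c \<and> well_formed d)"
| "well_formed (For i b c) = (well_formed c \<and> i \<notin> writes c \<and> i \<noteq> 1 \<and>
     writes (For i b c) \<inter> loop_bounds (For i b c) = {})"

lemma sem_frame:
  assumes "r \<notin> writes c"
  shows "fst (sem c s) r = fst s r"
  using assms
proof (induction c arbitrary: s)
  case (Basic ins)
  then show ?case by (cases s; cases ins) auto
next
  case (For i b c)
  have "fst (fold (\<lambda>k. sem c \<circ> enter_loop i m k) ks s) r = fst s r" for m ks
    using For by (induction ks arbitrary: s) (auto simp: enter_loop_def)
  then show ?case
    using For.prems by (auto simp: enter_loop_def)
qed auto

text \<open>Induction on the number of completed rounds, carrying the frame property along.
  \<open>R'\<close> in the conclusion stands for the registers after the last round, before the
  final test overwrites the counter and register 1.\<close>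

lemma sem_For_invariant:
  assumes base: "I 0 R M"
    and step: "\<And>k R' M'. \<lbrakk>k < R b; I k R' M'; \<And>r. r \<notin> writes (For i b c) \<Longrightarrow> R' r = R r\<rbrakk>
      \<Longrightarrow> case sem c (R'(i := k, 1 := R b - k), M') of (R'', M'') \<Rightarrow> I (Suc k) R'' M''"
  shows "\<exists>R'. I (R b) R' (snd (sem (For i b c) (R, M))) \<and>
    fst (sem (For i b c) (R, M)) = R'(i := R b, 1 := 0)"
proof -
  define f where "f = (\<lambda>k. sem c \<circ> enter_loop i (R b) k)"
  have "case fold f [0..<k] (R, M) of (R', M') \<Rightarrow>
      I k R' M' \<and> (\<forall>r. r \<notin> writes (For i b c) \<longrightarrow> R' r = R r)" if "k \<le> R b" for k
    using that
  proof (induction k)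
    case 0
    then show ?case using base by simp
  next
    case (Suc k)
    obtain R' M' where eq: "fold f [0..<k] (R, M) = (R', M')" by fastforce
    obtain R'' M'' where eq': "sem c (R'(i := k, 1 := R b - k), M') = (R'', M'')" by fastforce
    have I: "I k R' M'" "\<And>r. r \<notin> writes (For i b c) \<Longrightarrow> R' r = R r"
      using Suc eq by auto
    have "I (Suc k) R'' M''"
      using step[of k R' M'] Suc.prems I eq' by auto
    moreover have "R'' r = R r" if "r \<notin> writes (For i b c)" for r
      using that sem_frame[of r c "(R'(i := k, 1 := R b - k), M')"] eq' I(2) by auto
    moreover have "f k (R', M') = (R'', M'')"
      using eq' by (simp add: f_def enter_loop_def)
    then have "fold f [0..<Suc k] (R, M) = (R'', M'')"
      using eq by simp
    ultimately show ?case by simp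
  qed
  moreover obtain R' M' where "fold f [0..<R b] (R, M) = (R', M')" by fastforce
  moreover from this have "sem (For i b c) (R, M) = (R'(i := R b, 1 := 0), M')"
    by (simp add: f_def enter_loop_def)
  ultimately show ?thesis by fastforce
qed

text \<open>For loops whose registers carry nothing from one round to the next: the body may rely on
  the counter and on all registers that the loop does not write.\<close>

lemma sem_For_memory:
  assumes base: "I 0 M"
    and step: "\<And>k R' M'. \<lbrakk>k < R b; I k M'; R' i = k;
        \<And>r. r \<notin> writes (For i b c) \<Longrightarrow> R' r = R r\<rbrakk> \<Longrightarrow> I (Suc k) (snd (sem c (R', M')))"
    and "i \<noteq> 1"
  shows "I (R b) (snd (sem (For i b c) (R, M)))"
proof -
  have "\<exists>R'. I (R b) (snd (sem (For i b c) (R, M))) \<and>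
    fst (sem (For i b c) (R, M)) = R'(i := R b, 1 := 0)"
  proof (rule sem_For_invariant[of "\<lambda>k R M. I k M"])
    fix k R' M'
    assume "k < R b" "I k M'" "\<And>r. r \<notin> writes (For i b c) \<Longrightarrow> R' r = R r"
    then have "I (Suc k) (snd (sem c (R'(i := k, 1 := R b - k), M')))"
      using \<open>i \<noteq> 1\<close> by (intro step) auto
    then show "case sem c (R'(i := k, 1 := R b - k), M') of (R'', M'') \<Rightarrow> I (Suc k) M''"
      by (simp add: split_beta)
  qed (rule base)
  then show ?thesis by blast
qed


section \<open>Compilation to the machine\<close>

primrec code_size :: "com \<Rightarrow> nat" where
  "code_size Skip = 0"
| "code_size (Basic ins) = 1"
| "code_size (Seq c d) = code_size c + code_size d"
| "code_size (IfZero r c d) = code_size c + code_size d + 2"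
| "code_size (For i b c) = code_size c + 6"

text \<open>Jumps are absolute, so code is generated for a fixed start address \<open>l\<close>. A
  loop has its test at \<open>l + 1\<close> and its exit at
  \<open>l + code_size c + 6\<close>.\<close>

primrec compile :: "com \<Rightarrow> nat \<Rightarrow> instr list" where
  "compile Skip l = []"
| "compile (Basic ins) l = [ins]"
| "compile (Seq c d) l = compile c l @ compile d (l + code_size c)"
| "compile (IfZero r c d) l =
     [JumpZero r (l + code_size d + 2)] @ compile d (l + 1) @
     [Jump (l + code_size c + code_size d + 2)] @ compile c (l + code_size d + 2)"
| "compile (For i b c) l =
     [Const i 0, Sub 1 b i, JumpZero 1 (l + code_size c + 6)] @ compile c (l + 3) @
     [Const 1 1, Add i i 1, Jump (l + 1)]"

lemma length_compile [simp]: "length (compile c l) = code_size c"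
  by (induction c arbitrary: l) auto

text \<open>The variable stands for a bound on all loop bounds. A conditional adds at most a test
  and a jump. A loop pays 3 for setting its counter and for the final test, and each round pays 2
  for the test and 3 for the increment and the jump back.\<close>

primrec time_poly :: "com \<Rightarrow> nat poly" where
  "time_poly Skip = 0"
| "time_poly (Basic ins) = 1"
| "time_poly (Seq c d) = time_poly c + time_poly d"
| "time_poly (IfZero r c d) = time_poly c + time_poly d + [:2:]"
| "time_poly (For i b c) = [:3:] + [:0, 1:] * (time_poly c + [:5:])"

definition code_at :: "instr list \<Rightarrow> nat \<Rightarrow> instr list \<Rightarrow> bool" where
  "code_at P l C \<longleftrightarrow> (\<exists>xs ys. P = xs @ C @ ys \<and> length xs = l)"

lemma code_at_append:
  "code_at P l (C @ D) \<Longrightarrow> code_at P l C"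
  "code_at P l (C @ D) \<Longrightarrow> code_at P (l + length C) D"
  unfolding code_at_def by (metis append.assoc, metis append.assoc length_append)

lemma step_code_at:
  assumes "code_at P l C" "k < length C"
  shows "step P (l + k, s) = exec_instr (C ! k) (l + k, s)"
  using assms by (auto simp: code_at_def step_def halted_def nth_append)

lemma exec_sequential:
  "sequential ins \<Longrightarrow> exec_instr ins (pc, s) = (Suc pc, snd (exec_instr ins (0, s)))"
  by (cases s; cases ins) auto

definition reaches_within :: "instr list \<Rightarrow> nat \<Rightarrow> config \<Rightarrow> config \<Rightarrow> bool" where
  "reaches_within P t cf cf' \<longleftrightarrow> (\<exists>t'\<le>t. (step P ^^ t') cf = cf')"

lemma reaches_within_refl: "reaches_within P t cf cf"
  unfolding reaches_within_def by (intro exI[of _ 0]) auto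

lemma reaches_within_step: "step P cf = cf' \<Longrightarrow> reaches_within P 1 cf cf'"
  unfolding reaches_within_def by (intro exI[of _ 1]) auto

lemma reaches_within_trans:
  assumes "reaches_within P t cf cf'" "reaches_within P t' cf' cf''"
  shows "reaches_within P (t + t') cf cf''"
proof -
  obtain a b where "a \<le> t" "b \<le> t'" "(step P ^^ a) cf = cf'" "(step P ^^ b) cf' = cf''"
    using assms unfolding reaches_within_def by blast
  then show ?thesis
    unfolding reaches_within_def
    by (intro exI[of _ "b + a"]) (simp add: funpow_add)
qed

lemma reaches_within_mono:
  "reaches_within P t cf cf' \<Longrightarrow> t \<le> t' \<Longrightarrow> reaches_within P t' cf cf'"
  unfolding reaches_within_def using le_trans by blast

text \<open>Induction on \<open>c\<close>. One \<open>B\<close> serves all nested loops, since by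
  well-formedness and the frame property the loop bounds still have their initial values when they
  are read.\<close>

theorem compile_correct:
  assumes "well_formed c" "code_at P l (compile c l)" "\<And>r. r \<in> loop_bounds c \<Longrightarrow> fst s r \<le> B"
  shows "reaches_within P (poly (time_poly c) B) (l, s) (l + code_size c, sem c s)"
  using assms
proof (induction c arbitrary: l s)
  case Skip
  show ?case by (simp add: reaches_within_refl)
next
  case (Basic ins)
  then show ?case
    using step_code_at[of P l "[ins]" 0] exec_sequential[of ins l s]
    by (intro reaches_within_step[THEN reaches_within_mono]) auto
next
  case (Seq c d)
  have "reaches_within P (poly (time_poly c) B) (l, s) (l + code_size c, sem c s)"
    using Seq.prems by (intro Seq.IH) (auto dest: code_at_append)
  moreover have "reaches_within P (poly (time_poly d) B) (l + code_size c, sem c s)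
      (l + code_size c + code_size d, sem d (sem c s))"
  proof (intro Seq.IH)
    show "code_at P (l + code_size c) (compile d (l + code_size c))"
      using Seq.prems(2) code_at_append(2) by fastforce
  next
    fix r assume r: "r \<in> loop_bounds d"
    then have "r \<notin> writes c" using Seq.prems(1) by auto
    then show "fst (sem c s) r \<le> B" using sem_frame Seq.prems(3) r by simp
  qed (use Seq.prems in auto)
  ultimately show ?case
    using reaches_within_trans by (fastforce simp: add.assoc)
next
  case (IfZero r c d)
  let ?C = "compile (IfZero r c d) l"
  have at: "code_at P l ?C" by fact
  have "code_at P l ([JumpZero r (l + code_size d + 2)] @ compile d (l + 1) @
     [Jump (l + code_size c + code_size d + 2)] @ compile c (l + code_size d + 2))"
    using at by simp
  from code_at_append(2)[OF this]
  have at1: "code_at P (l + 1) (compile d (l + 1) @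
     [Jump (l + code_size c + code_size d + 2)] @ compile c (l + code_size d + 2))"
    by simp
  from code_at_append(2)[OF this]
  have at2: "code_at P (l + 1 + code_size d)
      ([Jump (l + code_size c + code_size d + 2)] @ compile c (l + code_size d + 2))"
    by simp
  from code_at_append(2)[OF this]
  have at3: "code_at P (l + code_size d + 2) (compile c (l + code_size d + 2))"
    by (simp add: ac_simps)
  have test: "reaches_within P 1 (l, s) (if fst s r = 0 then l + code_size d + 2 else l + 1, s)"
    using step_code_at[OF at, of 0 s] by (cases s) (intro reaches_within_step, simp)
  show ?case
  proof (cases "fst s r = 0")
    case True
    have "reaches_within P (poly (time_poly c) B) (l + code_size d + 2, s)
        (l + code_size d + 2 + code_size c, sem c s)"
      using IfZero.prems at3 by (intro IfZero.IH) auto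
    moreover have "reaches_within P 1 (l, s) (l + code_size d + 2, s)"
      using test True by simp
    ultimately have "reaches_within P (1 + poly (time_poly c) B) (l, s)
        (l + code_size d + 2 + code_size c, sem c s)"
      by (blast intro: reaches_within_trans)
    from reaches_within_mono[OF this, of "poly (time_poly (IfZero r c d)) B"] True
    show ?thesis by (simp add: ac_simps)
  next
    case False
    have "reaches_within P (poly (time_poly d) B) (l + 1, s) (l + 1 + code_size d, sem d s)"
      using IfZero.prems code_at_append(1)[OF at1] by (intro IfZero.IH) auto
    moreover have "reaches_within P 1 (l + 1 + code_size d, sem d s)
        (l + code_size (IfZero r c d), sem d s)"
      using step_code_at[OF at2, of 0 "sem d s"]
      by (cases "sem d s") (intro reaches_within_step, simp add: ac_simps)
    moreover have "reaches_within P 1 (l, s) (l + 1, s)"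
      using test False by simp
    ultimately have "reaches_within P (1 + (poly (time_poly d) B + 1)) (l, s)
        (l + code_size (IfZero r c d), sem d s)"
      by (blast intro: reaches_within_trans)
    from reaches_within_mono[OF this, of "poly (time_poly (IfZero r c d)) B"] False
    show ?thesis by simp
  qed
next
  case (For i b c)
  define m where "m = fst s b"
  define f where "f = (\<lambda>k. sem c \<circ> enter_loop i m k)"
  define T where "T = poly (time_poly c) B + 5"
  let ?body = "compile c (l + 3)" and ?e = "l + code_size c + 6"
  let ?C = "compile (For i b c) l"
  have at: "code_at P l ?C" by fact
  have "code_at P l ([Const i 0, Sub 1 b i, JumpZero 1 ?e] @ ?body @
      [Const 1 1, Add i i 1, Jump (l + 1)])"
    using at by simp
  from code_at_append(2)[OF this]
  have at1: "code_at P (l + 3) (?body @ [Const 1 1, Add i i 1, Jump (l + 1)])"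
    by (simp add: numeral_3_eq_3)
  from code_at_append(2)[OF this]
  have at2: "code_at P (l + 3 + code_size c) [Const 1 1, Add i i 1, Jump (l + 1)]"
    by simp
  have ib: "i \<noteq> b" "b \<noteq> 1" "i \<noteq> 1" "b \<notin> writes c" "i \<notin> writes c"
    using For.prems(1) by auto
  have start: "reaches_within P 1 (l, s) (l + 1, (fst s)(i := 0), snd s)"
    using step_code_at[OF at, of 0 s] by (cases s) (intro reaches_within_step, simp)
  have test: "reaches_within P 2 (l + 1, R, M)
      (if R b - R i = 0 then ?e else l + 3, R(1 := R b - R i), M)" for R M
  proof -
    have "reaches_within P 1 (l + 1, R, M) (l + 2, R(1 := R b - R i), M)"
      using step_code_at[OF at, of 1 "(R, M)"] by (intro reaches_within_step) simp
    moreover have "reaches_within P 1 (l + 2, R(1 := R b - R i), M)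
        (if R b - R i = 0 then ?e else l + 3, R(1 := R b - R i), M)"
      using step_code_at[OF at, of 2 "(R(1 := R b - R i), M)"] by (intro reaches_within_step) simp
    ultimately have "reaches_within P (1 + 1) (l + 1, R, M)
        (if R b - R i = 0 then ?e else l + 3, R(1 := R b - R i), M)"
      by (rule reaches_within_trans)
    then show ?thesis by (simp only: one_add_one)
  qed
  have repeat: "reaches_within P 3 (l + 3 + code_size c, R, M)
      (l + 1, R(1 := 1, i := R i + 1), M)" for R M
  proof -
    let ?l = "l + 3 + code_size c"
    have "reaches_within P 1 (?l, R, M) (?l + 1, R(1 := 1), M)"
      using step_code_at[OF at2, of 0 "(R, M)"] by (intro reaches_within_step) simp
    moreover have "reaches_within P 1 (?l + 1, R(1 := 1), M) (?l + 2, R(1 := 1, i := R i + 1), M)"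
      using step_code_at[OF at2, of 1 "(R(1 := 1), M)"] ib by (intro reaches_within_step) simp
    moreover have "reaches_within P 1 (?l + 2, R(1 := 1, i := R i + 1), M)
        (l + 1, R(1 := 1, i := R i + 1), M)"
      using step_code_at[OF at2, of 2 "(R(1 := 1, i := R i + 1), M)"]
      by (intro reaches_within_step) simp
    ultimately have "reaches_within P (1 + 1 + 1) (?l, R, M) (l + 1, R(1 := 1, i := R i + 1), M)"
      using reaches_within_trans by blast
    then show ?thesis by (simp add: numeral_3_eq_3)
  qed
  define g where "g k = fold f [0..<k] s" for k
  have frame: "fst (g k) r = fst s r" if "r \<notin> writes (For i b c)" for k r
    using that by (induction k) (auto simp: g_def f_def enter_loop_def sem_frame)
  \<comment> \<open>On arrival at the test, machine and \<open>sem\<close> may differ in the counter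
    and in register 1. The counter is already \<open>k\<close>, and the test overwrites register 1,
    which produces exactly the state \<open>enter_loop i m k (g k)\<close>.\<close>
  have iterate: "\<exists>R. reaches_within P (1 + k * T) (l, s) (l + 1, R, snd (g k)) \<and> R i = k \<and>
      (\<forall>r. r \<notin> {i, 1} \<longrightarrow> R r = fst (g k) r)" if "k \<le> m" for k
    using that
  proof (induction k)
    case 0
    show ?case using start by (auto simp: g_def)
  next
    case (Suc k)
    then obtain R where R: "reaches_within P (1 + k * T) (l, s) (l + 1, R, snd (g k))" "R i = k"
      "\<And>r. r \<notin> {i, 1} \<Longrightarrow> R r = fst (g k) r" by auto
    have "R b = m" using R(3)[of b] frame[of b k] ib by (auto simp: m_def)
    define S where "S = enter_loop i m k (g k)"
    have S: "(R(1 := R b - R i), snd (g k)) = S"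
      using R ib \<open>R b = m\<close> by (auto simp: S_def enter_loop_def fun_eq_iff)
    have 1: "reaches_within P 2 (l + 1, R, snd (g k)) (l + 3, S)"
      using test[of R "snd (g k)"] S Suc.prems R(2) \<open>R b = m\<close> by simp
    have "reaches_within P (poly (time_poly c) B) (l + 3, S) (l + 3 + code_size c, sem c S)"
    proof (intro For.IH)
      fix r assume "r \<in> loop_bounds c"
      then have "r \<notin> writes (For i b c)" "fst s r \<le> B" using For.prems by auto
      then show "fst S r \<le> B" using frame[of r k] by (auto simp: S_def enter_loop_def)
    qed (use For.prems code_at_append(1)[OF at1] in auto)
    moreover have "sem c S = g (Suc k)" by (simp add: S_def g_def f_def)
    ultimately have 2: "reaches_within P (poly (time_poly c) B) (l + 3, S)
        (l + 3 + code_size c, g (Suc k))" by simp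
    let ?R = "(fst (g (Suc k)))(1 := 1, i := fst (g (Suc k)) i + 1)"
    have "reaches_within P 3 (l + 3 + code_size c, g (Suc k)) (l + 1, ?R, snd (g (Suc k)))"
      using repeat[of "fst (g (Suc k))" "snd (g (Suc k))"] by simp
    from reaches_within_trans[OF R(1) reaches_within_trans[OF 1 reaches_within_trans[OF 2 this]]]
    have 3: "reaches_within P (1 + Suc k * T) (l, s) (l + 1, ?R, snd (g (Suc k)))"
      by (simp add: T_def algebra_simps)
    have 4: "?R i = Suc k"
      using sem_frame[of i c S] ib \<open>sem c S = g (Suc k)\<close> by (simp add: S_def enter_loop_def)
    have 5: "\<forall>r. r \<notin> {i, 1} \<longrightarrow> ?R r = fst (g (Suc k)) r" by simp
    from 3 4 5 show ?case by blast

  qed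
  obtain R where R: "reaches_within P (1 + m * T) (l, s) (l + 1, R, snd (g m))" "R i = m"
    "\<And>r. r \<notin> {i, 1} \<Longrightarrow> R r = fst (g m) r" using iterate[of m] by auto
  have "R b = m" using R(3)[of b] frame[of b m] ib by (auto simp: m_def)
  have "(R(1 := R b - R i), snd (g m)) = enter_loop i m m (g m)"
    using R ib \<open>R b = m\<close> by (auto simp: enter_loop_def fun_eq_iff)
  then have "reaches_within P 2 (l + 1, R, snd (g m)) (?e, enter_loop i m m (g m))"
    using test[of R "snd (g m)"] R(2) \<open>R b = m\<close> by simp
  from reaches_within_trans[OF R(1) this]
  have "reaches_within P (1 + m * T + 2) (l, s) (?e, enter_loop i m m (g m))" .
  moreover have "m * T \<le> B * T" using For.prems(3)[of b] by (simp add: m_def)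
  then have "1 + m * T + 2 \<le> poly (time_poly (For i b c)) B"
    by (simp add: T_def algebra_simps)
  ultimately have "reaches_within P (poly (time_poly (For i b c)) B) (l, s)
      (?e, enter_loop i m m (g m))"
    by (rule reaches_within_mono)
  then show ?case
    by (simp add: g_def f_def m_def add.assoc)
qed


section \<open>The program\<close>

primrec block :: "com list \<Rightarrow> com" where
  "block [] = Skip"
| "block (c # cs) = Seq c (block cs)"

text \<open>
  With \<open>n\<close> the number of vertices and \<open>N = n\<^sup>2\<close>, registers 0, 2, 3, 4, 5 hold \<open>N + 1\<close>, \<open>n\<close>, \<open>N\<close>,
  \<open>2N\<close>, 1. The pair \<open>(i, j)\<close> of vertices is numbered \<open>i * n + j\<close>. The nodes \<open>p\<close> and
  \<open>p + N\<close> stand for the statement that pair \<open>p\<close> has colour 1 and for its negation; the label of node \<open>x\<close> is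
  kept in memory cell \<open>N + 1 + x\<close>.
\<close>

definition prelude :: com where
  "prelude = block [Basic (Load 2 1), Basic (Const 5 1), Basic (Sub 3 0 5), Basic (Add 4 3 3)]"

definition init_labels :: com where
  "init_labels = For 6 4 (block [Basic (Add 15 0 6), Basic (Store 15 15)])"

text \<open>Repeated addition, as the machine has no multiplication.\<close>

definition times_n :: "nat \<Rightarrow> nat \<Rightarrow> com" where
  "times_n d a = Seq (Basic (Const d 0)) (For 6 2 (Basic (Add d d a)))"

text \<open>Both labels are fetched before the loop, which overwrites the cell of the first one. As
  subtraction is truncated, equality is tested by adding the differences in both directions.\<close>

definition merge :: "nat \<Rightarrow> nat \<Rightarrow> com" where
  "merge a b = block [Basic (Load 18 a), Basic (Load 19 b),
     For 6 4 (block [Basic (Add 20 0 6), Basic (Load 21 20),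
       Basic (Sub 22 21 18), Basic (Sub 23 18 21), Basic (Add 22 22 23),
       IfZero 22 (Basic (Store 20 19)) Skip])]"

text \<open>Registers 12, 13, 15 become the label addresses of the first pair, the second pair and
  the negation of the second. Registers 7 and 9 hold the outer vertices of the triple. Each
  constraint is merged together with its negated form.\<close>

definition join_pairs :: com where
  "join_pairs = block [Basic (Add 12 12 3), Basic (Add 13 13 3), Basic (Add 15 13 3),
     Basic (Sub 14 7 9), Basic (Sub 16 9 7), Basic (Add 14 14 16),
     IfZero 14 (block [merge 12 13, Basic (Add 12 12 3), merge 12 15])
               (block [merge 12 15, Basic (Add 12 12 3), merge 12 13])]"

text \<open>Registers 7, 8, 9 hold the triple. Adding register 5, which is 1, to a pair number skips
  cell 0 and gives the address of the matrix entry.\<close>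

definition process_triple :: com where
  "process_triple = block [times_n 10 7, times_n 11 8,
     Basic (Add 12 10 8), Basic (Add 12 12 5), Basic (Add 13 11 9), Basic (Add 13 13 5),
     Basic (Add 14 10 9), Basic (Add 14 14 5),
     Basic (Load 15 12), Basic (Load 16 13), Basic (Load 17 14),
     IfZero 15 Skip (IfZero 16 Skip (IfZero 17 join_pairs Skip))]"

text \<open>A pair that shares its label with its negation clears the flag in cell 0. The colour of
  an edge replaces its matrix entry; labels lie above the matrix, so none is lost.\<close>

definition readout_pair :: com where
  "readout_pair = block [Basic (Add 12 6 5), Basic (Add 13 12 3), Basic (Add 14 13 3),
     Basic (Load 13 13), Basic (Load 14 14),
     Basic (Sub 15 13 14), Basic (Sub 16 14 13), Basic (Add 17 15 16),
     IfZero 17 (block [Basic (Const 18 0), Basic (Store 18 18)]) Skip,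
     Basic (Load 19 12),
     IfZero 19 Skip
       (IfZero 15 (Basic (Store 12 5)) (block [Basic (Add 20 5 5), Basic (Store 12 20)]))]"

text \<open>Cell 0, no longer needed for the number of vertices, becomes the success flag. On
  failure the output length drops to 1; otherwise register 0 still covers the flag and the
  matrix.\<close>

definition readout :: com where
  "readout = block [Basic (Const 16 0), Basic (Store 16 5),
     For 6 3 readout_pair,
     Basic (Const 16 0), Basic (Load 16 16), IfZero 16 (Basic (Const 0 1)) Skip]"

definition process_triples :: com where
  "process_triples = For 7 2 (For 8 2 (For 9 2 process_triple))"

definition main :: com where
  "main = block [init_labels, process_triples, readout]"

lemmas program_defs = prelude_def init_labels_def times_n_def merge_def join_pairs_def
  process_triple_def readout_pair_def readout_def process_triples_def main_def

lemma well_formed_program: "well_formed prelude" "well_formed main"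
  by (simp_all add: program_defs)

lemma loop_bounds_program: "loop_bounds prelude = {}" "loop_bounds main = {2, 3, 4}"
  by (auto simp: program_defs)

section \<open>The effect of the program pieces on the memory\<close>

definition relabel :: "nat \<Rightarrow> nat \<Rightarrow> nat \<Rightarrow> nat \<Rightarrow> (nat \<Rightarrow> nat) \<Rightarrow> nat \<Rightarrow> nat" where
  "relabel b m u v M a = (if b \<le> a \<and> a < b + m \<and> M a = u then v else M a)"

text \<open>The second relabelling reads its labels from \<open>M'\<close>, since the first one may
  have changed them.\<close>

definition join :: "nat \<Rightarrow> nat \<Rightarrow> nat \<Rightarrow> bool \<Rightarrow> (nat \<Rightarrow> nat) \<Rightarrow> nat \<Rightarrow> nat" where
  "join N p q same M =
     (let q' = (if same then q else q + N); q'' = (if same then q + N else q);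
          M' = relabel (N + 1) (2 * N) (M (N + 1 + p)) (M (N + 1 + q')) M
      in relabel (N + 1) (2 * N) (M' (N + 1 + (p + N))) (M' (N + 1 + q'')) M')"

lemma sem_init_labels:
  "snd (sem init_labels (R, M)) = (\<lambda>a. if R 0 \<le> a \<and> a < R 0 + R 4 then a else M a)"
  unfolding init_labels_def
  by (rule sem_For_memory[where I = "\<lambda>k M'. M' = (\<lambda>a. if R 0 \<le> a \<and> a < R 0 + k then a else M a)"])
    (auto simp: fun_eq_iff)

lemma sem_times_n:
  assumes "d \<notin> {1, 2, 6}" "a \<notin> {1, 6, d}"
  shows "snd (sem (times_n d a) (R, M)) = M" "fst (sem (times_n d a) (R, M)) d = R a * R 2"
proof -
  let ?R = "R(d := 0)"
  have "\<exists>R'. (R' d = R a * ?R 2 \<and> snd (sem (For 6 2 (Basic (Add d d a))) (?R, M)) = M) \<and>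
    fst (sem (For 6 2 (Basic (Add d d a))) (?R, M)) = R'(6 := ?R 2, 1 := 0)"
    by (rule sem_For_invariant[where I = "\<lambda>k R' M'. R' d = R a * k \<and> M' = M"])
      (use assms in auto)
  then show "snd (sem (times_n d a) (R, M)) = M" "fst (sem (times_n d a) (R, M)) d = R a * R 2"
    using assms by (auto simp: times_n_def)
qed

text \<open>Register 18 is excluded because the first load overwrites it before \<open>b\<close> is
  used as an address.\<close>

lemma sem_merge:
  assumes "b \<noteq> 18"
  shows "snd (sem (merge a b) (R, M)) = relabel (R 0) (R 4) (M (R a)) (M (R b)) M"
proof -
  let ?R = "R(18 := M (R a), 19 := M (R b))"
  let ?c = "block [Basic (Add 20 0 6), Basic (Load 21 20),
       Basic (Sub 22 21 18), Basic (Sub 23 18 21), Basic (Add 22 22 23),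
       IfZero 22 (Basic (Store 20 19)) Skip]"
  have "snd (sem (For 6 4 ?c) (?R, M)) = relabel (R 0) (?R 4) (M (R a)) (M (R b)) M"
    by (rule sem_For_memory[where I = "\<lambda>k M'. M' = relabel (R 0) k (M (R a)) (M (R b)) M"])
      (auto simp: fun_eq_iff relabel_def less_Suc_eq)
  with assms show ?thesis by (simp add: merge_def)
qed

lemma sem_join_pairs:
  assumes "R 0 = N + 1" "R 3 = N" "R 4 = 2 * N" "R 12 = 1 + p" "R 13 = 1 + q"
  shows "snd (sem join_pairs (R, M)) = join N p q (R 7 = R 9) M"
proof -
  have join_aux: "snd (sem (block [merge 12 a, Basic (Add 12 12 3), merge 12 b]) (R', M)) =
      (let M' = relabel (R' 0) (R' 4) (M (R' 12)) (M (R' a)) M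
       in relabel (R' 0) (R' 4) (M' (R' 12 + R' 3)) (M' (R' b)) M')"
    if "a \<in> {13, 15}" "b \<in> {13, 15}" for a b R'
  proof -
    obtain S M1 where s: "sem (merge 12 a) (R', M) = (S, M1)" by fastforce
    have M1: "M1 = relabel (R' 0) (R' 4) (M (R' 12)) (M (R' a)) M"
      using that sem_merge[of a 12 R' M] s by auto
    have S: "S r = R' r" if "r \<in> {0, 3, 4, 12, 13, 15}" for r
      using that sem_frame[of r "merge 12 a" "(R', M)"] s by (auto simp: merge_def)
    let ?S = "S(12 := R' 12 + R' 3)"
    have "snd (sem (block [merge 12 a, Basic (Add 12 12 3), merge 12 b]) (R', M)) =
        snd (sem (merge 12 b) (?S, M1))"
      by (simp add: s S)
    also have "\<dots> = relabel (?S 0) (?S 4) (M1 (?S 12)) (M1 (?S b)) M1"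
      using that by (intro sem_merge) auto
    finally have eq: "snd (sem (block [merge 12 a, Basic (Add 12 12 3), merge 12 b]) (R', M)) =
        relabel (?S 0) (?S 4) (M1 (?S 12)) (M1 (?S b)) M1" .
    have "?S 0 = R' 0" "?S 4 = R' 4" "?S 12 = R' 12 + R' 3" "?S b = R' b"
      using that by (auto simp: S)
    with eq M1 show ?thesis by (simp only: Let_def)
  qed
  show ?thesis
    using assms unfolding join_pairs_def
    by (auto simp del: block.simps simp: block.simps(2)[of "Basic _"] block.simps(2)[of "IfZero _ _ _"]
      block.simps(1) join_aux join_def Let_def ac_simps)
qed

text \<open>The case \<open>i = k\<close> is included: a simple graph has no loops, so
  \<open>(i, j, i)\<close> is active for every edge \<open>ij\<close> and asks that both
  orientations get the same colour.\<close>

definition active :: "nat \<Rightarrow> (nat \<Rightarrow> nat) \<Rightarrow> nat \<Rightarrow> nat \<Rightarrow> nat \<Rightarrow> bool" where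
  "active n A i j k \<longleftrightarrow>
     A (1 + (i * n + j)) \<noteq> 0 \<and> A (1 + (j * n + k)) \<noteq> 0 \<and> A (1 + (i * n + k)) = 0"

definition layout :: "nat \<Rightarrow> (nat \<Rightarrow> nat) \<Rightarrow> bool" where
  "layout n R \<longleftrightarrow> R 0 = n * n + 1 \<and> R 2 = n \<and> R 3 = n * n \<and> R 4 = 2 * (n * n) \<and> R 5 = 1"

lemma layout_cong:
  "layout n R \<Longrightarrow> (\<And>r. r \<in> {0, 2, 3, 4, 5} \<Longrightarrow> R' r = R r) \<Longrightarrow> layout n R'"
  by (simp add: layout_def)

lemma sem_process_triple:
  assumes "layout n R" "R 7 = i" "R 8 = j" "R 9 = k"
  shows "snd (sem process_triple (R, M)) =
    (if active n M i j k then join (n * n) (i * n + j) (j * n + k) (i = k) M else M)"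
proof -
  obtain R1 where R1: "sem (times_n 10 7) (R, M) = (R1, M)" "R1 10 = i * n"
    using sem_times_n[of 10 7 R M] assms by (cases "sem (times_n 10 7) (R, M)") (auto simp: layout_def)
  have f1: "R1 r = R r" if "r \<notin> {1, 6, 10}" for r
    using sem_frame[of r "times_n 10 7" "(R, M)"] R1(1) that by (auto simp: times_n_def)
  obtain R2 where R2: "sem (times_n 11 8) (R1, M) = (R2, M)" "R2 11 = j * n"
    using sem_times_n[of 11 8 R1 M] assms f1 by (cases "sem (times_n 11 8) (R1, M)") (auto simp: layout_def)
  have f2: "R2 r = R1 r" if "r \<notin> {1, 6, 11}" for r
    using sem_frame[of r "times_n 11 8" "(R1, M)"] R2(1) that by (auto simp: times_n_def)
  show ?thesis
    using assms R1 R2 unfolding process_triple_def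
    by (simp add: f1 f2 layout_def active_def sem_join_pairs[where N = "n * n" and p = "i * n + j" and q = "j * n + k"])
qed


section \<open>Labels and signs\<close>

text \<open>A system of linear equations over the two-element field, with one unknown per ordered
  pair and one equation per active triple; \<open>c p\<close> says that pair \<open>p\<close> has
  colour 1.\<close>

definition consistent :: "nat \<Rightarrow> (nat \<Rightarrow> nat) \<Rightarrow> (nat \<Rightarrow> bool) \<Rightarrow> bool" where
  "consistent n A c \<longleftrightarrow> (\<forall>i<n. \<forall>j<n. \<forall>k<n. active n A i j k \<longrightarrow>
     ((c (i * n + j) \<longleftrightarrow> c (j * n + k)) \<longleftrightarrow> i = k))"

definition sign :: "nat \<Rightarrow> (nat \<Rightarrow> bool) \<Rightarrow> nat \<Rightarrow> bool" where
  "sign N c x = (if x < N then c x else \<not> c (x - N))"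

text \<open>Soundness of the labels: they identify only nodes that have equal truth values under
  \<open>c\<close>.\<close>

definition faithful :: "nat \<Rightarrow> (nat \<Rightarrow> bool) \<Rightarrow> (nat \<Rightarrow> nat) \<Rightarrow> bool" where
  "faithful N c M \<longleftrightarrow> (\<forall>x<2 * N. \<forall>y<2 * N.
     M (N + 1 + x) = M (N + 1 + y) \<longrightarrow> sign N c x = sign N c y)"

text \<open>Completeness of the labels: the trace that a processed constraint leaves. If colours
  must differ, the two labels of one pair are those of the other exchanged.\<close>

definition linked :: "nat \<Rightarrow> nat \<Rightarrow> nat \<Rightarrow> bool \<Rightarrow> (nat \<Rightarrow> nat) \<Rightarrow> bool" where
  "linked N p q same M \<longleftrightarrow>
     M (N + 1 + p) = M (N + 1 + (if same then q else q + N)) \<and>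
     M (N + 1 + (p + N)) = M (N + 1 + (if same then q + N else q))"

lemma relabel_outside: "a < b \<Longrightarrow> relabel b m u v M a = M a"
  by (simp add: relabel_def)

lemma relabel_cong:
  "x < m \<Longrightarrow> y < m \<Longrightarrow> M (b + x) = M (b + y) \<Longrightarrow>
    relabel b m u v M (b + x) = relabel b m u v M (b + y)"
  by (simp add: relabel_def)

lemma relabel_identifies:
  "x < m \<Longrightarrow> y < m \<Longrightarrow>
    relabel b m (M (b + x)) (M (b + y)) M (b + x) = relabel b m (M (b + x)) (M (b + y)) M (b + y)"
  by (simp add: relabel_def)

text \<open>Truth values are constant on each of the two merged classes, and the representatives
  \<open>x\<close> and \<open>y\<close> show that the constants agree.\<close>

lemma faithful_relabel:
  assumes "faithful N c M" "x < 2 * N" "y < 2 * N" "sign N c x = sign N c y"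
  shows "faithful N c (relabel (N + 1) (2 * N) (M (N + 1 + x)) (M (N + 1 + y)) M)"
  using assms unfolding faithful_def relabel_def
  by (smt (verit, best) add_less_cancel_left le_add1)

text \<open>Both merges join nodes of equal sign, the second one joining the negations of the nodes
  of the first.\<close>

lemma faithful_join:
  assumes "faithful N c M" "p < N" "q < N" "(c p \<longleftrightarrow> c q) \<longleftrightarrow> same"
  shows "faithful N c (join N p q same M)"
  unfolding join_def Let_def
  using assms by (intro faithful_relabel) (auto simp: sign_def)

lemma linked_join:
  assumes "p < N" "q < N"
  shows "linked N p q same (join N p q same M)"
  using assms unfolding linked_def join_def Let_def
  by (cases same) (auto intro!: relabel_cong relabel_identifies simp del: add_Suc add_Suc_right)

text \<open>Relabelling depends only on the old label of a node, so equal labels stay equal. Hence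
  no merge undoes an earlier one, and a single pass over the triples suffices.\<close>

lemma linked_relabel:
  assumes "linked N p q same M" "p < N" "q < N"
  shows "linked N p q same (relabel (N + 1) (2 * N) u v M)"
  using assms by (auto simp: linked_def relabel_def)

lemma linked_join_other:
  assumes "linked N p q same M" "p < N" "q < N"
  shows "linked N p q same (join N p' q' same' M)"
  unfolding join_def Let_def using assms by (intro linked_relabel)

lemma join_outside: "a \<le> N \<Longrightarrow> join N p q same M a = M a"
  by (simp add: join_def Let_def relabel_outside)

lemma pair_number_less:
  assumes "i < n" "j < n"
  shows "i * n + j < n * (n::nat)"
proof -
  have "i * n + j < Suc i * n" using assms by simp
  also have "\<dots> \<le> n * n" using assms by (intro mult_le_mono1) simp
  finally show ?thesis .
qed

text \<open>\<open>T\<close> collects the processed triples. The first clause keeps the input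
  intact, so activity can be tested in the current memory.\<close>

definition invariant :: "nat \<Rightarrow> (nat \<Rightarrow> nat) \<Rightarrow> (nat \<times> nat \<times> nat) set \<Rightarrow> (nat \<Rightarrow> nat) \<Rightarrow> bool" where
  "invariant n A T M \<longleftrightarrow>
     (\<forall>a\<le>n * n. M a = A a) \<and>
     (\<forall>c. consistent n A c \<longrightarrow> faithful (n * n) c M) \<and>
     (\<forall>(i, j, k)\<in>T. active n A i j k \<longrightarrow> linked (n * n) (i * n + j) (j * n + k) (i = k) M)"

lemma active_cong:
  assumes "\<And>a. a \<le> n * n \<Longrightarrow> M a = A a" "i < n" "j < n" "k < n"
  shows "active n M i j k = active n A i j k"
  using assms pair_number_less[of i n j] pair_number_less[of j n k] pair_number_less[of i n k]
  by (simp add: active_def)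

lemma invariant_process_triple:
  assumes "layout n R" "R 7 = i" "R 8 = j" "R 9 = k" and ijk: "i < n" "j < n" "k < n"
    and inv: "invariant n A T M" and T: "T \<subseteq> {..<n} \<times> {..<n} \<times> {..<n}"
  shows "invariant n A (insert (i, j, k) T) (snd (sem process_triple (R, M)))"
proof -
  have eq: "snd (sem process_triple (R, M)) =
    (if active n M i j k then join (n * n) (i * n + j) (j * n + k) (i = k) M else M)"
    by (rule sem_process_triple) fact+
  have act: "active n M i j k = active n A i j k"
    using inv ijk by (intro active_cong) (auto simp: invariant_def)
  show ?thesis
  proof (cases "active n A i j k")
    case False
    then show ?thesis using inv act eq by (auto simp: invariant_def)
  next
    case True
    have less: "i * n + j < n * n" "j * n + k < n * n"
      using ijk by (simp_all add: pair_number_less)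
    let ?M = "join (n * n) (i * n + j) (j * n + k) (i = k) M"
    have "faithful (n * n) c ?M" if "consistent n A c" for c
      using that inv True ijk less
      by (intro faithful_join) (auto simp: invariant_def consistent_def)
    moreover have "linked (n * n) (i' * n + j') (j' * n + k') (i' = k') ?M"
      if "(i', j', k') \<in> insert (i, j, k) T" "active n A i' j' k'" for i' j' k'
    proof (cases "(i', j', k') = (i, j, k)")
      case True
      then show ?thesis using less by (auto intro: linked_join)
    next
      case False
      then have "(i', j', k') \<in> T" using that(1) by blast
      then have "linked (n * n) (i' * n + j') (j' * n + k') (i' = k') M"
        using inv that by (auto simp: invariant_def)
      moreover have "i' < n" "j' < n" "k' < n"
        using \<open>(i', j', k') \<in> T\<close> T by auto
      ultimately show ?thesis by (intro linked_join_other) (simp_all add: pair_number_less)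
    qed
    ultimately have "invariant n A (insert (i, j, k) T) ?M"
      using inv by (auto simp: invariant_def join_outside)
    with eq act True show ?thesis by simp
  qed
qed

text \<open>Lexicographic initial segments. Completing an inner loop gives the same set as starting
  the next round of the loop around it, so the three loop invariants fit together.\<close>

definition triples_before :: "nat \<Rightarrow> nat \<Rightarrow> nat \<Rightarrow> nat \<Rightarrow> (nat \<times> nat \<times> nat) set" where
  "triples_before n i j k = {(a, b, c). a < n \<and> b < n \<and> c < n \<and>
     (a < i \<or> a = i \<and> (b < j \<or> b = j \<and> c < k))}"

lemma triples_before_Suc:
  "i < n \<Longrightarrow> j < n \<Longrightarrow> k < n \<Longrightarrow>
    triples_before n i j (Suc k) = insert (i, j, k) (triples_before n i j k)"
  "triples_before n i j n = triples_before n i (Suc j) 0"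
  "triples_before n i n 0 = triples_before n (Suc i) 0 0"
  by (auto simp: triples_before_def)

lemma writes_program:
  "writes process_triple = {1, 6, 10, 11, 12, 13, 14, 15, 16, 17, 18, 19, 20, 21, 22, 23}"
  "writes init_labels = {1, 6, 15}"
  "writes process_triples = {1, 6, 7, 8, 9, 10, 11, 12, 13, 14, 15, 16, 17, 18, 19, 20, 21, 22, 23}"
  by (auto simp: program_defs)

lemma invariant_process_triples:
  assumes "layout n R" "invariant n A {} M"
  shows "invariant n A ({..<n} \<times> {..<n} \<times> {..<n}) (snd (sem process_triples (R, M)))"
proof -
  define J where "J i j k = invariant n A (triples_before n i j k)" for i j k
  have inner: "J i j n (snd (sem (For 9 2 process_triple) (R, M)))"
    if R: "layout n R" "R 7 = i" "R 8 = j" and ij: "i < n" "j < n" and J: "J i j 0 M" for i j R M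
  proof -
    have "J i j (R 2) (snd (sem (For 9 2 process_triple) (R, M)))"
    proof (rule sem_For_memory[where I = "J i j"])
      fix k R' M'
      assume *: "k < R 2" "J i j k M'" "R' 9 = k"
        and frame: "\<And>r. r \<notin> writes (For 9 2 process_triple) \<Longrightarrow> R' r = R r"
      have "layout n R'" by (rule layout_cong[OF R(1)], rule frame) (auto simp: writes_program)
      moreover have "R' 7 = i" "R' 8 = j" using frame R by (auto simp: writes_program)
      moreover have "k < n" using * R by (simp add: layout_def)
      ultimately have "invariant n A (insert (i, j, k) (triples_before n i j k)) (snd (sem process_triple (R', M')))"
        using ij *(2,3) by (intro invariant_process_triple) (auto simp: J_def triples_before_def)
      then show "J i j (Suc k) (snd (sem process_triple (R', M')))"
        using ij \<open>k < n\<close> by (simp add: J_def triples_before_Suc)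
    qed (use J in auto)
    then show ?thesis using R by (simp add: layout_def)
  qed
  have middle: "J i n 0 (snd (sem (For 8 2 (For 9 2 process_triple)) (R, M)))"
    if R: "layout n R" "R 7 = i" and i: "i < n" and J: "J i 0 0 M" for i R M
  proof -
    have "J i (R 2) 0 (snd (sem (For 8 2 (For 9 2 process_triple)) (R, M)))"
    proof (rule sem_For_memory[where I = "\<lambda>j. J i j 0"])
      fix j R' M'
      assume *: "j < R 2" "J i j 0 M'" "R' 8 = j"
        and frame: "\<And>r. r \<notin> writes (For 8 2 (For 9 2 process_triple)) \<Longrightarrow> R' r = R r"
      have "layout n R'" by (rule layout_cong[OF R(1)], rule frame) (auto simp: writes_program)
      moreover have "R' 7 = i" using frame R by (auto simp: writes_program)
      moreover have "j < n" using * R by (simp add: layout_def)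
      ultimately have "J i j n (snd (sem (For 9 2 process_triple) (R', M')))"
        using i *(2,3) by (intro inner)
      then show "J i (Suc j) 0 (snd (sem (For 9 2 process_triple) (R', M')))"
        by (simp add: J_def triples_before_Suc)
    qed (use J in auto)
    then show ?thesis using R by (simp add: layout_def)
  qed
  have "J (R 2) 0 0 (snd (sem process_triples (R, M)))"
    unfolding process_triples_def
  proof (rule sem_For_memory[where I = "\<lambda>i. J i 0 0"])
    fix i R' M'
    assume *: "i < R 2" "J i 0 0 M'" "R' 7 = i"
      and frame: "\<And>r. r \<notin> writes (For 7 2 (For 8 2 (For 9 2 process_triple))) \<Longrightarrow> R' r = R r"
    have "layout n R'" by (rule layout_cong[OF assms(1)], rule frame) (auto simp: writes_program)
    moreover have "i < n" using * assms by (simp add: layout_def)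
    ultimately have "J i n 0 (snd (sem (For 8 2 (For 9 2 process_triple)) (R', M')))"
      using *(2,3) by (intro middle)
    then show "J (Suc i) 0 0 (snd (sem (For 8 2 (For 9 2 process_triple)) (R', M')))"
      by (simp add: J_def triples_before_Suc)
  next
    show "J 0 0 0 M" using assms by (auto simp: J_def triples_before_def invariant_def)
  qed simp
  moreover have "triples_before n n 0 0 = {..<n} \<times> {..<n} \<times> {..<n}"
    by (auto simp: triples_before_def)
  ultimately show ?thesis using assms by (simp add: J_def layout_def)
qed


section \<open>Reading the answer off the labels\<close>

definition clash :: "nat \<Rightarrow> (nat \<Rightarrow> nat) \<Rightarrow> bool" where
  "clash N M \<longleftrightarrow> (\<exists>p<N. M (N + 1 + p) = M (N + 1 + (p + N)))"

text \<open>Matrix cell \<open>a\<close> belongs to pair \<open>a - 1\<close>, whose label is in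
  cell \<open>N + a\<close> and that of its negation in \<open>N + a + N\<close>.\<close>

lemma sem_readout:
  assumes "layout n R" and N: "N = n * n" and s: "sem readout (R, M) = (R', M')"
  shows "M' 0 = (if clash N M then 0 else 1)"
    "R' 0 = (if clash N M then 1 else N + 1)"
    "\<And>a. 0 < a \<Longrightarrow> a \<le> N \<Longrightarrow>
      M' a = (if M a = 0 then 0 else if M (N + a) \<le> M (N + a + N) then 1 else 2)"
proof -
  let ?R = "R(16 := 0)" and ?M = "M(0 := 1)"
  \<comment> \<open>The second clause covers all positive addresses, so the labels are known to be
    untouched when later pairs are read.\<close>
  define I where "I k M' \<longleftrightarrow>
      M' 0 = (if \<exists>p<k. M (N + 1 + p) = M (N + 1 + (p + N)) then 0 else 1) \<and>
      (\<forall>a>0. M' a = (if a \<le> k \<and> M a \<noteq> 0 then if M (N + a) \<le> M (N + a + N) then 1 else 2 else M a))"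
    for k and M' :: "nat \<Rightarrow> nat"
  have R: "R 0 = N + 1" "R 3 = N" "R 5 = 1" using assms by (auto simp: layout_def)
  have "I (?R 3) (snd (sem (For 6 3 readout_pair) (?R, ?M)))"
  proof (rule sem_For_memory[where I = I])
    show "I 0 ?M" by (auto simp: I_def)
  next
    fix k R' M'
    assume "k < ?R 3" and I: "I k M'" and k: "R' 6 = k"
      and frame: "\<And>r. r \<notin> writes (For 6 3 readout_pair) \<Longrightarrow> R' r = ?R r"
    have R': "R' 0 = N + 1" "R' 3 = N" "R' 5 = 1" "k < N"
      using frame R \<open>k < ?R 3\<close> by (auto simp: readout_pair_def)
    define x y where "x = M (N + 1 + k)" and "y = M (N + 1 + (k + N))"
    have M': "M' (Suc (k + N)) = x" "M' (Suc (k + N + N)) = y" "M' (Suc k) = M (Suc k)"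
      using I R'(4) by (auto simp: I_def x_def y_def ac_simps)
    have "snd (sem readout_pair (R', M')) =
        (if M (Suc k) = 0 then M'(0 := if x = y then 0 else M' 0)
         else M'(0 := if x = y then 0 else M' 0, Suc k := if x \<le> y then 1 else 2))"
      using R' k M' by (auto simp: readout_pair_def fun_eq_iff)
    then show "I (Suc k) (snd (sem readout_pair (R', M')))"
      using I by (auto simp: I_def less_Suc_eq le_Suc_eq x_def y_def ac_simps)
  qed simp
  then have loop: "I N (snd (sem (For 6 3 readout_pair) (?R, ?M)))" using R by simp
  obtain R1 M1 where 1: "sem (For 6 3 readout_pair) (?R, ?M) = (R1, M1)" by fastforce
  have "R1 0 = N + 1"
    using sem_frame[of 0 "For 6 3 readout_pair" "(?R, ?M)"] 1 R by (simp add: readout_pair_def)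
  have "R' = (if M1 0 = 0 then R1(16 := 0, 0 := 1) else R1(16 := M1 0))" "M' = M1"
    using s 1 R by (auto simp: readout_def split: if_splits)
  with loop 1 \<open>R1 0 = N + 1\<close>
  show "M' 0 = (if clash N M then 0 else 1)"
    "R' 0 = (if clash N M then 1 else N + 1)"
    "\<And>a. 0 < a \<Longrightarrow> a \<le> N \<Longrightarrow>
      M' a = (if M a = 0 then 0 else if M (N + a) \<le> M (N + a + N) then 1 else 2)"
    by (auto simp: I_def clash_def)
qed

lemma invariant_cong:
  assumes "invariant n A T M"
  shows "consistent n M = consistent n A"
  using assms active_cong[of n M A] by (auto simp: consistent_def invariant_def fun_eq_iff)

text \<open>A pair and its negation have opposite signs under every \<open>c\<close>, so a faithful
  labelling cannot identify them.\<close>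

lemma clash_inconsistent:
  assumes "invariant n A T M" "clash (n * n) M"
  shows "\<not> consistent n A c"
proof
  assume "consistent n A c"
  then have f: "faithful (n * n) c M" using assms by (simp add: invariant_def)
  obtain p where p: "p < n * n" "M (n * n + 1 + p) = M (n * n + 1 + (p + n * n))"
    using assms by (auto simp: clash_def)
  then have "sign (n * n) c p = sign (n * n) c (p + n * n)"
    by (intro f[unfolded faithful_def, rule_format]) auto
  then show False using p(1) by (simp add: sign_def)
qed

text \<open>Equality constraints copy the two compared labels and so preserve the comparison. The
  others exchange them, which reverses it because without a clash the labels are distinct.\<close>

lemma clash_free_consistent:
  assumes inv: "invariant n A ({..<n} \<times> {..<n} \<times> {..<n}) M" and "\<not> clash (n * n) M"
  shows "consistent n A (\<lambda>p. M (n * n + 1 + p) \<le> M (n * n + 1 + (p + n * n)))"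
  unfolding consistent_def
proof (intro allI impI)
  fix i j k assume "i < n" "j < n" "k < n" "active n A i j k"
  then have "linked (n * n) (i * n + j) (j * n + k) (i = k) M" "i * n + j < n * n"
    using inv by (auto simp: invariant_def pair_number_less)
  moreover from this assms(2) have
    "M (n * n + 1 + (i * n + j)) \<noteq> M (n * n + 1 + (i * n + j + n * n))"
    by (auto simp: clash_def)
  ultimately show "((M (n * n + 1 + (i * n + j)) \<le> M (n * n + 1 + (i * n + j + n * n))) =
      (M (n * n + 1 + (j * n + k)) \<le> M (n * n + 1 + (j * n + k + n * n)))) = (i = k)"
    unfolding linked_def by (cases "i = k") (auto simp only: if_True if_False simp_thms)
qed

theorem sem_main:
  assumes "layout n R" and N: "N = n * n" and s: "sem main (R, M) = (R', M')"
  shows "if \<exists>c. consistent n M c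
    then R' 0 = N + 1 \<and> M' 0 = 1 \<and> (\<exists>c. consistent n M c \<and>
      (\<forall>p<N. M' (Suc p) = (if M (Suc p) = 0 then 0 else if c p then 1 else 2)))
    else R' 0 = 1 \<and> M' 0 = 0"
proof -
  obtain R1 M1 where 1: "sem init_labels (R, M) = (R1, M1)" by fastforce
  have M1: "M1 = (\<lambda>a. if N < a \<and> a < N + 1 + 2 * N then a else M a)"
    using sem_init_labels[of R M] 1 assms by (simp add: layout_def Suc_le_eq)
  have "layout n R1"
    using sem_frame[of _ init_labels "(R, M)"] 1
    by (intro layout_cong[OF assms(1)]) (auto simp: writes_program)
  \<comment> \<open>Initially every node is labelled by the address of its own cell, so all labels
    are distinct.\<close>
  have "invariant n M {} M1"
    by (auto simp: invariant_def faithful_def M1 N)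
  obtain R2 M2 where 2: "sem process_triples (R1, M1) = (R2, M2)" by fastforce
  have inv: "invariant n M ({..<n} \<times> {..<n} \<times> {..<n}) M2"
    using invariant_process_triples[OF \<open>layout n R1\<close> \<open>invariant n M {} M1\<close>] 2 by simp
  have "layout n R2"
    using sem_frame[of _ process_triples "(R1, M1)"] 2
    by (intro layout_cong[OF \<open>layout n R1\<close>]) (auto simp: writes_program)
  have 3: "sem readout (R2, M2) = (R', M')"
    using s 1 2 by (simp add: main_def)
  note readout = sem_readout[OF \<open>layout n R2\<close> N 3]
  have same: "M2 a = M a" if "a \<le> N" for a using inv that by (auto simp: invariant_def N)
  show ?thesis
  proof (cases "clash N M2")
    case True
    then have "\<nexists>c. consistent n M c" using clash_inconsistent[OF inv] N by blast
    with True readout show ?thesis by simp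
  next
    case False
    let ?c = "\<lambda>p. M2 (N + 1 + p) \<le> M2 (N + 1 + (p + N))"
    have c: "consistent n M ?c" using clash_free_consistent[OF inv] False N by simp
    moreover have "M' (Suc p) = (if M (Suc p) = 0 then 0 else if ?c p then 1 else 2)" if "p < N" for p
      using readout(3)[of "Suc p"] same[of "Suc p"] that by (simp add: ac_simps)
    ultimately have "\<exists>c. consistent n M c \<and>
        (\<forall>p<N. M' (Suc p) = (if M (Suc p) = 0 then 0 else if c p then 1 else 2))" by blast
    with c False readout(1,2) show ?thesis by auto
  qed
qed


section \<open>Graphs\<close>

lemma nth_concat_map:
  assumes "i < length us" "j < length vs"
  shows "concat (map (\<lambda>u. map (f u) vs) us) ! (i * length vs + j) = f (us ! i) (vs ! j)"
  using assms
proof (induction us arbitrary: i)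
  case (Cons u us)
  then show ?case by (cases i) (auto simp: nth_append)
qed simp

text \<open>Passes from the row-by-row form of the codes to indexing by pair numbers, as used by the
  program.\<close>

lemma concat_map_square:
  fixes vs :: "'a list"
  defines "n \<equiv> length vs"
  shows "concat (map (\<lambda>u. map (f u) vs) vs) = map (\<lambda>p. f (vs ! (p div n)) (vs ! (p mod n))) [0..<n * n]"
proof (rule nth_equalityI)
  have "length (concat (map (\<lambda>u. map (f u) vs) us)) = length us * n" for us
    by (induction us) (auto simp: n_def)
  then show len: "length (concat (map (\<lambda>u. map (f u) vs) vs)) =
      length (map (\<lambda>p. f (vs ! (p div n)) (vs ! (p mod n))) [0..<n * n])"
    by (simp add: n_def)
  fix p assume "p < length (concat (map (\<lambda>u. map (f u) vs) vs))"
  with len have p: "p < n * n" by simp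
  then have "p div n < n" "p mod n < n"
    by (auto simp: less_mult_imp_div_less) (metis mod_less_divisor mult_is_0 gr0I not_less0)
  then show "concat (map (\<lambda>u. map (f u) vs) vs) ! p =
      map (\<lambda>p. f (vs ! (p div n)) (vs ! (p mod n))) [0..<n * n] ! p"
    using nth_concat_map[of "p div n" vs "p mod n" vs f] p by (simp add: n_def)
qed

definition graph_memory :: "'a list \<Rightarrow> 'a set set \<Rightarrow> nat \<Rightarrow> nat" where
  "graph_memory vs E = snd (snd (init_config (graph_code vs E)))"

lemma graph_code_eq:
  "graph_code vs E = length vs # map (\<lambda>p. if {vs ! (p div length vs), vs ! (p mod length vs)} \<in> E then 1 else 0)
     [0..<length vs * length vs]"
  by (simp add: graph_code_def concat_map_square)

lemma colouring_code_eq: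
  "colouring_code vs E c = map (\<lambda>p. if {vs ! (p div length vs), vs ! (p mod length vs)} \<in> E
     then c {vs ! (p div length vs), vs ! (p mod length vs)} else 0) [0..<length vs * length vs]"
  by (simp add: colouring_code_def concat_map_square)

lemma graph_memory_0: "graph_memory vs E 0 = length vs"
  by (simp add: graph_memory_def init_config_def graph_code_eq)

lemma graph_memory_Suc:
  "p < length vs * length vs \<Longrightarrow> graph_memory vs E (Suc p) =
     (if {vs ! (p div length vs), vs ! (p mod length vs)} \<in> E then 1 else 0)"
  by (simp add: graph_memory_def init_config_def graph_code_eq)

lemma pair_number_div_mod:
  "j < n \<Longrightarrow> (i * n + j) div n = i" "j < n \<Longrightarrow> (i * n + j) mod n = (j::nat)"
  by auto

lemma graph_memory_pair:
  "i < length vs \<Longrightarrow> j < length vs \<Longrightarrow>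
    graph_memory vs E (Suc (i * length vs + j)) = (if {vs ! i, vs ! j} \<in> E then 1 else 0)"
  using pair_number_less[of i "length vs" j] by (simp add: graph_memory_Suc pair_number_div_mod)

lemma active_graph_memory:
  assumes "i < length vs" "j < length vs" "k < length vs"
  shows "active (length vs) (graph_memory vs E) i j k \<longleftrightarrow>
    {vs ! i, vs ! j} \<in> E \<and> {vs ! j, vs ! k} \<in> E \<and> {vs ! i, vs ! k} \<notin> E"
  using assms by (simp add: active_def graph_memory_pair)

text \<open>Ties a colouring to the solution that the machine writes out; mere existence of a
  colouring would not identify the output as its code.\<close>

definition agrees :: "'a list \<Rightarrow> 'a set set \<Rightarrow> ('a set \<Rightarrow> nat) \<Rightarrow> (nat \<Rightarrow> bool) \<Rightarrow> bool" where
  "agrees vs E c d \<longleftrightarrow> (\<forall>i<length vs. \<forall>j<length vs. {vs ! i, vs ! j} \<in> E \<longrightarrow>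
     c {vs ! i, vs ! j} = (if d (i * length vs + j) then 1 else 2))"

text \<open>Colour 1 is read as true. For \<open>i = k\<close> both pairs are the same edge;
  otherwise equal colours would make the outer vertices adjacent by local completeness at the middle
  one.\<close>

lemma consistent_if_locally_complete:
  assumes "distinct vs" "set vs = V" "locally_complete_colouring V E c"
  shows "\<exists>d. consistent (length vs) (graph_memory vs E) d"
proof -
  define d where "d p \<longleftrightarrow> c {vs ! (p div length vs), vs ! (p mod length vs)} = 1" for p
  have d: "d (i * length vs + j) \<longleftrightarrow> c {vs ! i, vs ! j} = 1" if "j < length vs" for i j
    using that by (simp add: d_def pair_number_div_mod)
  have "(d (i * length vs + j) \<longleftrightarrow> d (j * length vs + k)) \<longleftrightarrow> i = k"
    if "i < length vs" "j < length vs" "k < length vs"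
      and act: "{vs ! i, vs ! j} \<in> E" "{vs ! j, vs ! k} \<in> E" "{vs ! i, vs ! k} \<notin> E" for i j k
  proof (cases "i = k")
    case True
    then show ?thesis using that by (simp add: d insert_commute)
  next
    case False
    have "c {vs ! i, vs ! j} \<noteq> c {vs ! j, vs ! k}"
    proof
      assume eq: "c {vs ! i, vs ! j} = c {vs ! j, vs ! k}"
      let ?m = "c {vs ! j, vs ! k}"
      have "?m \<in> {1, 2}"
        using assms(3) act by (auto simp: locally_complete_colouring_def two_edge_colouring_def)
      then have "induces_complete E (colour_nbrs E c (vs ! j) ?m)"
        using assms that unfolding locally_complete_colouring_def by (metis nth_mem)
      moreover have "vs ! i \<in> colour_nbrs E c (vs ! j) ?m" "vs ! k \<in> colour_nbrs E c (vs ! j) ?m"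
        using act eq by (auto simp: colour_nbrs_def insert_commute)
      moreover have "vs ! i \<noteq> vs ! k" using False that assms(1) by (simp add: nth_eq_iff_index_eq)
      ultimately show False using act by (auto simp: induces_complete_def)
    qed
    \<comment> \<open>With only two colours, different colours means that exactly one of them is
      1.\<close>
    moreover have "c {vs ! i, vs ! j} \<in> {1, 2}" "c {vs ! j, vs ! k} \<in> {1, 2}"
      using assms(3) act by (auto simp: locally_complete_colouring_def two_edge_colouring_def)
    ultimately show ?thesis using False that by (auto simp: d)
  qed
  then show ?thesis by (auto simp: consistent_def active_graph_memory)
qed

text \<open>Triples \<open>(i, j, i)\<close> make the solution symmetric on edges, so it induces an
  edge colouring; triples with distinct ends make this locally complete.\<close>

lemma locally_complete_if_consistent:
  assumes "simple_graph V E" "distinct vs" "set vs = V"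
    and cons: "consistent (length vs) (graph_memory vs E) d"
  shows "\<exists>c. locally_complete_colouring V E c \<and> agrees vs E c d"
proof -
  let ?n = "length vs"
  \<comment> \<open>One true orientation suffices for colour 1; on edges the symmetry shown below
    makes both orientations agree.\<close>
  define c :: "_ \<Rightarrow> nat"
    where "c e = (if \<exists>i<?n. \<exists>j<?n. e = {vs ! i, vs ! j} \<and> d (i * ?n + j) then 1 else 2)" for e
  have card: "card e = 2" "e \<subseteq> V" if "e \<in> E" for e
    using assms(1) that by (auto simp: simple_graph_def)
  have sym: "d (i * ?n + j) = d (j * ?n + i)" if "i < ?n" "j < ?n" "{vs ! i, vs ! j} \<in> E" for i j
  proof -
    have "{vs ! i, vs ! i} \<notin> E" using card(1) by fastforce
    then have "active ?n (graph_memory vs E) i j i"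
      using that by (simp add: active_graph_memory insert_commute)
    then show ?thesis using cons that unfolding consistent_def by blast
  qed
  have agrees: "agrees vs E c d"
    unfolding agrees_def
  proof (intro allI impI)
    fix i j assume ij: "i < ?n" "j < ?n" "{vs ! i, vs ! j} \<in> E"
    have "d (i' * ?n + j') = d (i * ?n + j)"
      if "i' < ?n" "j' < ?n" "{vs ! i, vs ! j} = {vs ! i', vs ! j'}" for i' j'
    proof -
      have "i' = i \<and> j' = j \<or> i' = j \<and> j' = i"
        using that ij assms(2) by (auto simp: doubleton_eq_iff nth_eq_iff_index_eq)
      then show ?thesis using sym[OF ij] by auto
    qed
    then show "c {vs ! i, vs ! j} = (if d (i * ?n + j) then 1 else 2)"
      using ij unfolding c_def by (smt (verit, best))
  qed
  have "two_edge_colouring E c" by (auto simp: two_edge_colouring_def c_def)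
  moreover have "induces_complete E (colour_nbrs E c v m)" for v m
    unfolding induces_complete_def
  proof (intro ballI impI)
    fix u w assume uw: "u \<in> colour_nbrs E c v m" "w \<in> colour_nbrs E c v m" "u \<noteq> w"
    then have E: "{v, u} \<in> E" "{v, w} \<in> E" "c {v, u} = c {v, w}" by (auto simp: colour_nbrs_def)
    then have "u \<in> set vs" "v \<in> set vs" "w \<in> set vs" using card(2) assms(3) by auto
    then obtain i j k where ijk: "i < ?n" "u = vs ! i" "j < ?n" "v = vs ! j" "k < ?n" "w = vs ! k"
      by (metis in_set_conv_nth)
    have flip: "{vs ! i, vs ! j} = {vs ! j, vs ! i}" by blast
    have "c {vs ! i, vs ! j} = (if d (i * ?n + j) then 1 else 2)"
      using agrees E(1) ijk flip unfolding agrees_def by metis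
    moreover have "c {vs ! j, vs ! k} = (if d (j * ?n + k) then 1 else 2)"
      using agrees E(2) ijk unfolding agrees_def by metis
    moreover have "c {vs ! i, vs ! j} = c {vs ! j, vs ! k}"
      using E(3) ijk(2,4,6) flip by metis
    ultimately have "d (i * ?n + j) = d (j * ?n + k)"
      by (metis one_eq_numeral_iff semiring_norm(85))
    moreover have "i \<noteq> k" using uw ijk by auto
    ultimately have "\<not> active ?n (graph_memory vs E) i j k"
      using cons ijk unfolding consistent_def by blast
    then show "{u, w} \<in> E" using E ijk by (simp add: active_graph_memory insert_commute)
  qed
  ultimately show ?thesis using agrees by (auto simp: locally_complete_colouring_def)
qed

lemma correct_output:
  assumes "simple_graph V E" "distinct vs" "set vs = V" and n: "n = length vs"
    and "layout n R" and s: "sem main (R, graph_memory vs E) = (R', M')"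
  shows "correct_answer V E vs (map M' [0..<R' 0])"
proof -
  note main = sem_main[OF \<open>layout n R\<close> refl s]
  have ex: "(\<exists>c. locally_complete_colouring V E c) \<longleftrightarrow> (\<exists>d. consistent n (graph_memory vs E) d)"
    using consistent_if_locally_complete locally_complete_if_consistent assms(1-3) n by metis
  show ?thesis
  proof (cases "\<exists>d. consistent n (graph_memory vs E) d")
    case False
    then show ?thesis using main ex by (simp add: correct_answer_def)
  next
    case True
    with main obtain d where out: "R' 0 = n * n + 1" "M' 0 = 1" "consistent n (graph_memory vs E) d"
      and M': "\<And>p. p < n * n \<Longrightarrow>
        M' (Suc p) = (if graph_memory vs E (Suc p) = 0 then 0 else if d p then 1 else 2)"
      by auto
    obtain c where c: "locally_complete_colouring V E c" "agrees vs E c d"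
      using locally_complete_if_consistent assms(1-3) n out(3) by blast
    have "M' (Suc p) = (if {vs ! (p div n), vs ! (p mod n)} \<in> E then c {vs ! (p div n), vs ! (p mod n)} else 0)"
      if p: "p < n * n" for p
    proof -
      have "0 < n" using p by (cases n) auto
      then have "p div n < n" "p mod n < n" using p by (auto simp: less_mult_imp_div_less)
      then have "{vs ! (p div n), vs ! (p mod n)} \<in> E \<Longrightarrow>
          c {vs ! (p div n), vs ! (p mod n)} = (if d (p div n * n + p mod n) then 1 else 2)"
        using c(2) n unfolding agrees_def by blast
      then show ?thesis using M'[OF p] p n by (simp add: graph_memory_Suc)
    qed
    then have "map M' [0..<R' 0] = 1 # colouring_code vs E c"
      using out(1,2) by (simp add: colouring_code_eq n upt_conv_Cons map_Suc_upt[symmetric] del: upt_Suc)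
    with c(1) show ?thesis by (auto simp: correct_answer_def)
  qed
qed

theorem corollary2:
  shows "\<exists>(P :: instr list) (p :: nat poly).
    \<forall>(V :: nat set) (E :: nat set set) (vs :: nat list).
      simple_graph V E \<and> distinct vs \<and> set vs = V \<longrightarrow>
      (\<exists>t ys. t \<le> poly p (length (graph_code vs E)) \<and>
              computes_within P (graph_code vs E) t ys \<and>
              correct_answer V E vs ys)"
\<comment> \<open>The time polynomial takes a bound on the loop bounds. The largest of these is
  twice the number of pairs, less than twice the input length, whence the composition with
  \<open>[:0, 2:]\<close>.\<close>
proof (intro exI[of _ "compile (Seq prelude main) 0"]
    exI[of _ "pcompose (time_poly (Seq prelude main)) [:0, 2:]"] allI impI)
  fix V :: "nat set" and E :: "nat set set" and vs :: "nat list"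
  assume *: "simple_graph V E \<and> distinct vs \<and> set vs = V"
  let ?xs = "graph_code vs E" and ?M = "graph_memory vs E" and ?n = "length vs"
  let ?P = "compile (Seq prelude main) 0" and ?B = "2 * length ?xs"
  obtain R0 where R0: "init_config ?xs = (0, R0, ?M)" "R0 0 = ?n * ?n + 1" "R0 1 = 0"
    by (auto simp: init_config_def graph_memory_def graph_code_eq)
  \<comment> \<open>Register 1 is 0 at the start, so \<open>Load 2 1\<close> fetches cell 0, the
    number of vertices.\<close>
  obtain R where R: "sem prelude (R0, ?M) = (R, ?M)" "layout ?n R"
    using R0(2,3) by (auto simp: prelude_def layout_def graph_memory_0)
  obtain R' M' where out: "sem main (R, ?M) = (R', M')" by fastforce
  have at: "code_at ?P 0 (compile prelude 0 @ compile main (code_size prelude))"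
    by (auto simp: code_at_def)
  \<comment> \<open>The two parts are treated separately: \<open>prelude\<close> writes the
    registers that bound the loops of \<open>main\<close>, so their sequence is not
    \<open>well_formed\<close>.\<close>
  have "reaches_within ?P (poly (time_poly prelude) ?B) (0, R0, ?M) (0 + code_size prelude, R, ?M)"
    using compile_correct[of prelude ?P 0 "(R0, ?M)" ?B] code_at_append(1)[OF at] R(1)
    by (simp add: well_formed_program loop_bounds_program)
  moreover have "reaches_within ?P (poly (time_poly main) ?B) (0 + code_size prelude, R, ?M)
      (length ?P, R', M')"
  proof -
    have "fst (R, ?M) r \<le> ?B" if "r \<in> loop_bounds main" for r
    proof -
      have "?n \<le> 2 + 2 * (?n * ?n)" using le_square[of ?n] by linarith
      then show ?thesis
        using that R(2) by (auto simp: loop_bounds_program layout_def graph_code_eq)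
    qed
    then show ?thesis
      using compile_correct[of main ?P "code_size prelude" "(R, ?M)" ?B] code_at_append(2)[OF at] out
      by (simp add: well_formed_program)
  qed
  ultimately have "reaches_within ?P (poly (time_poly (Seq prelude main)) ?B)
      (init_config ?xs) (length ?P, R', M')"
    unfolding R0(1) by (simp only: time_poly.simps poly_add) (rule reaches_within_trans)
  then obtain t where t: "t \<le> poly (time_poly (Seq prelude main)) ?B"
    "(step ?P ^^ t) (init_config ?xs) = (length ?P, R', M')"
    unfolding reaches_within_def by blast
  show "\<exists>t ys. t \<le> poly (pcompose (time_poly (Seq prelude main)) [:0, 2:]) (length ?xs) \<and>
      computes_within ?P ?xs t ys \<and> correct_answer V E vs ys"
  proof (intro exI conjI)
    show "t \<le> poly (pcompose (time_poly (Seq prelude main)) [:0, 2:]) (length ?xs)"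
      using t(1) by (simp add: poly_pcompose mult.commute)
    show "computes_within ?P ?xs t (map M' [0..<R' 0])"
      using t(2) by (simp add: computes_within_def halted_def ram_output_def)
    show "correct_answer V E vs (map M' [0..<R' 0])"
      using * R(2) out by (intro correct_output) auto
  qed
qed

end
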